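(* There exists an infinite, proper, uniformly discrete, complete metric space $M$ such that $c_0$ is not isometrically contained in $\operatorname{SNA}(M)$ and such that every point of $M$ attains its separation radius.
   Context: All vector spaces are real. Let $(M,d)$ be a pointed metric space, i.e. a metric space with a distinguished point $0\in M$ (its choice is irrelevant, since $f\mapsto f-f(0)$ is a linear isometry between the corresponding spaces preserving strong norm attainment). $\operatorname{Lip}_0(M)$ is the Banach space of all Lipschitz functions $f:M\to\mathbb{R}$ with $f(0)=0$, with norm $\|f\|_{\operatorname{Lip}}=\sup\{|f(y)-f(x)|/d(x,y): x,y\in M,\ x\ne y\}$. A function $f\in\operatorname{Lip}_0(M)$ strongly attains its norm if there are distinct $p,q\in M$ with $\|f\|_{\operatorname{Lip}}=|f(p)-f(q)|/d(p,q)$. $\operatorname{SNA}(M)\subseteq\operatorname{Lip}_0(M)$ is the set of all functions that strongly attain their norm. A Banach space $Y$ is isometrically contained in $\operatorname{SNA}(M)$ if there is a linear isometric embedding $U:Y\to\operatorname{Lip}_0(M)$ with $U(Y)\subseteq\operatorname{SNA}(M)$. $c_0$ is the space of real sequences converging to $0$ with the supremum norm. The separation radius of $x\in M$ is $R(x)=\inf\{d(x,y): y\in M\setminus\{x\}\}$; $x$ attains its separation radius if there is $y\in M\setminus\{x\}$ with $R(x)=d(x,y)$. $M$ is uniformly discrete if $\inf\{R(x):x\in M\}>0$, and proper if every closed and bounded subset of $M$ is compact. *)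

theory Defs
  imports "HOL-Analysis.Analysis"
begin

(* 0 is inserted only so that the supremum is 0, and not unspecified, on a one-point space;
   the difference quotients are nonnegative, so it changes nothing elsewhere. *)
definition lip_norm :: "'a metric \<Rightarrow> ('a \<Rightarrow> real) \<Rightarrow> real" where
  "lip_norm m f =
     Sup (insert 0 {\<bar>f y - f x\<bar> / mdist m x y | x y. x \<in> mspace m \<and> y \<in> mspace m \<and> x \<noteq> y})"

(* A function on the carrier is represented by its extension by 0, so that each element of
   Lip_0 has a unique representative and Lip_0 is a linear subspace of the full function space. *)
definition Lip0 :: "'a metric \<Rightarrow> 'a \<Rightarrow> ('a \<Rightarrow> real) set" where
  "Lip0 m z = {f. Lipschitz_continuous_map m euclidean_metric f \<and> f z = 0 \<and>
                  (\<forall>x. x \<notin> mspace m \<longrightarrow> f x = 0)}"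

definition strongly_attains_norm :: "'a metric \<Rightarrow> ('a \<Rightarrow> real) \<Rightarrow> bool" where
  "strongly_attains_norm m f \<longleftrightarrow>
     (\<exists>p\<in>mspace m. \<exists>q\<in>mspace m. p \<noteq> q \<and> lip_norm m f = \<bar>f p - f q\<bar> / mdist m p q)"

definition SNA :: "'a metric \<Rightarrow> 'a \<Rightarrow> ('a \<Rightarrow> real) set" where
  "SNA m z = {f \<in> Lip0 m z. strongly_attains_norm m f}"

(* Y is meant to be a closed linear subspace of a Banach space, with the inherited norm. *)
definition isometrically_contained_in_SNA ::
    "'b::real_normed_vector set \<Rightarrow> 'a metric \<Rightarrow> 'a \<Rightarrow> bool" where
  "isometrically_contained_in_SNA Y m z \<longleftrightarrow>
     (\<exists>U :: 'b \<Rightarrow> 'a \<Rightarrow> real.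
        (\<forall>a\<in>Y. U a \<in> Lip0 m z) \<and>
        (\<forall>a\<in>Y. \<forall>b\<in>Y. U (a + b) = (\<lambda>x. U a x + U b x)) \<and>
        (\<forall>a\<in>Y. \<forall>r. U (r *\<^sub>R a) = (\<lambda>x. r * U a x)) \<and>
        (\<forall>a\<in>Y. lip_norm m (U a) = norm a) \<and>
        U ` Y \<subseteq> SNA m z)"

(* nat carries the discrete topology, so the ambient type is the space of all bounded real
   sequences with the supremum norm. *)
definition c0 :: "(nat \<Rightarrow>\<^sub>C real) set" where
  "c0 = {a. apply_bcontfun a \<longlonglongrightarrow> 0}"

(* The infimum is a genuine one only if the space has at least two points. *)
definition sep_radius :: "'a metric \<Rightarrow> 'a \<Rightarrow> real" where
  "sep_radius m x = (INF y\<in>mspace m - {x}. mdist m x y)"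

definition attains_sep_radius :: "'a metric \<Rightarrow> 'a \<Rightarrow> bool" where
  "attains_sep_radius m x \<longleftrightarrow> (\<exists>y\<in>mspace m - {x}. sep_radius m x = mdist m x y)"

definition uniformly_discrete :: "'a metric \<Rightarrow> bool" where
  "uniformly_discrete m \<longleftrightarrow> (INF x\<in>mspace m. sep_radius m x) > 0"

definition proper_metric :: "'a metric \<Rightarrow> bool" where
  "proper_metric m \<longleftrightarrow>
     (\<forall>S. closedin (mtopology_of m) S \<and> Metric_space.mbounded (mspace m) (mdist m) S
          \<longrightarrow> compactin (mtopology_of m) S)"

end

(* Let d(x,y) = x + y + 2 - 1/(min x y + 1) for distinct naturals x, y. In an isometric copy of c0
   inside SNA, the images f_k of the unit vectors satisfy |f_j x - f_j y| + |f_k x - f_k y| \<le> d(x,y)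
   for j \<noteq> k, and f_k attains its norm 1 at some pair p_k < q_k, on which every other f_j is
   therefore constant. If p_k > q_0 for some k, adding up the estimates for the four pairs between
   {p_0,q_0} and {p_k,q_k} gives
     d(p_0,q_0) + d(p_k,q_k) \<le> (d(p_0,p_k) + d(p_0,q_k) + d(q_0,p_k) + d(q_0,q_k)) / 2,
   which fails because 1/(n+1) is strictly decreasing. Otherwise two of the p_k coincide, and then
   d(q_j,q_k) \<ge> d(p_k,q_j) + d(p_k,q_k), contradicting the strict triangle inequality. *)

theory Submission
  imports Defs
begin

lemma mdist_pos: "x \<in> mspace m \<Longrightarrow> y \<in> mspace m \<Longrightarrow> x \<noteq> y \<Longrightarrow> 0 < mdist m x y"
  using mdist_zero[of x m y] mdist_nonneg[of m x y] by linarith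

text \<open>A Lipschitz constant of \<open>f\<close> bounds all difference quotients, so the
  supremum in \<open>lip_norm\<close> is a genuine one.\<close>

lemma lip_norm_bound:
  assumes f: "f \<in> Lip0 m z" and x: "x \<in> mspace m" and y: "y \<in> mspace m"
  shows "\<bar>f y - f x\<bar> \<le> lip_norm m f * mdist m x y"
proof (cases "x = y")
  case True
  then have "mdist m x y = 0" using x by simp
  then show ?thesis using True by simp
next
  case False
  let ?Q = "{\<bar>f y - f x\<bar> / mdist m x y | x y. x \<in> mspace m \<and> y \<in> mspace m \<and> x \<noteq> y}"
  obtain B where "\<forall>x\<in>mspace m. \<forall>y\<in>mspace m. dist (f x) (f y) \<le> B * mdist m x y"
    using f unfolding Lip0_def Lipschitz_continuous_map_def mdist_euclidean_metric by blast
  then have B: "\<bar>f y - f x\<bar> \<le> B * mdist m x y" if "x \<in> mspace m" "y \<in> mspace m" for x y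
    using that by (metis dist_real_def abs_minus_commute)
  \<comment> \<open>The maximum with 0 covers the inserted element 0, since on a one-point space
    \<open>B\<close> may be negative.\<close>
  have "t \<le> max 0 B" if "t \<in> insert 0 ?Q" for t
    using that
  proof (elim insertE)
    assume "t \<in> ?Q"
    then obtain u v where t: "t = \<bar>f v - f u\<bar> / mdist m u v"
      and uv: "u \<in> mspace m" "v \<in> mspace m" "u \<noteq> v" by blast
    have "t \<le> B" using B[OF uv(1,2)] mdist_pos[OF uv] by (simp add: t divide_le_eq)
    then show ?thesis by simp
  qed simp
  then have "bdd_above (insert 0 ?Q)" by (rule bdd_aboveI)
  moreover have "\<bar>f y - f x\<bar> / mdist m x y \<in> insert 0 ?Q" using False x y by blast
  ultimately have "\<bar>f y - f x\<bar> / mdist m x y \<le> lip_norm m f"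
    unfolding lip_norm_def by (rule cSup_upper[rotated])
  then show ?thesis using mdist_pos[OF x y False] by (simp add: divide_le_eq)
qed

definition unit_seq :: "nat \<Rightarrow> nat \<Rightarrow>\<^sub>C real" where
  "unit_seq k = Bcontfun (\<lambda>n. if n = k then 1 else 0)"

lemma apply_unit_seq: "apply_bcontfun (unit_seq k) n = (if n = k then 1 else 0)"
proof -
  have "(\<lambda>n. if n = k then 1 else 0::real) \<in> bcontfun"
    by (rule bcontfun_normI[where b = 1]) auto
  then show ?thesis by (simp add: unit_seq_def Bcontfun_inverse)
qed

lemma unit_seq_in_c0: "unit_seq k \<in> c0"
proof -
  have "eventually (\<lambda>n. apply_bcontfun (unit_seq k) n = 0) sequentially"
    using eventually_gt_at_top[of k] by eventually_elim (simp add: apply_unit_seq)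
  then show ?thesis by (simp add: c0_def tendsto_eventually)
qed

lemma scaleR_in_c0: "a \<in> c0 \<Longrightarrow> r *\<^sub>R a \<in> c0"
  by (simp add: c0_def tendsto_mult_right_zero)

lemma add_in_c0: "a \<in> c0 \<Longrightarrow> b \<in> c0 \<Longrightarrow> a + b \<in> c0"
  by (simp add: c0_def tendsto_add_zero)

lemma norm_unit_seq: "norm (unit_seq k) = 1"
proof (rule antisym)
  show "norm (unit_seq k) \<le> 1" by (rule norm_bound) (simp add: apply_unit_seq)
  show "1 \<le> norm (unit_seq k)"
    using norm_bounded[of "unit_seq k" k] by (simp add: apply_unit_seq)
qed

text \<open>The two summands have disjoint supports, so every coordinate is 1, \<open>r\<close> or
  0.\<close>

lemma norm_unit_seq_add_le:
  assumes "j \<noteq> k" "\<bar>r\<bar> \<le> 1"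
  shows "norm (unit_seq j + r *\<^sub>R unit_seq k) \<le> 1"
  by (rule norm_bound) (use assms in \<open>simp add: apply_unit_seq\<close>)

text \<open>Reduces an embedding to metric data: \<open>f k\<close> is the image of the k-th unit
  vector. The first property tests the isometry on sums and differences of two unit vectors, the
  second is norm attainment at norm 1.\<close>

lemma isometric_c0_in_SNA_imp_norming_pairs:
  fixes m :: "'a metric"
  assumes "isometrically_contained_in_SNA c0 m z"
  shows "\<exists>f :: nat \<Rightarrow> 'a \<Rightarrow> real.
    (\<forall>j k. j \<noteq> k \<longrightarrow> (\<forall>x\<in>mspace m. \<forall>y\<in>mspace m.
        \<bar>f j x - f j y\<bar> + \<bar>f k x - f k y\<bar> \<le> mdist m x y)) \<and>
    (\<forall>k. \<exists>p\<in>mspace m. \<exists>q\<in>mspace m. p \<noteq> q \<and> \<bar>f k p - f k q\<bar> = mdist m p q)"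
proof -
  from assms obtain U :: "(nat \<Rightarrow>\<^sub>C real) \<Rightarrow> 'a \<Rightarrow> real" where
    Lip: "\<forall>a\<in>c0. U a \<in> Lip0 m z" and
    add: "\<forall>a\<in>c0. \<forall>b\<in>c0. U (a + b) = (\<lambda>x. U a x + U b x)" and
    scale: "\<forall>a\<in>c0. \<forall>r. U (r *\<^sub>R a) = (\<lambda>x. r * U a x)" and
    norm: "\<forall>a\<in>c0. lip_norm m (U a) = norm a" and
    SNA: "U ` c0 \<subseteq> SNA m z"
    unfolding isometrically_contained_in_SNA_def by (elim exE conjE) (rule that; assumption)
  let ?f = "\<lambda>k. U (unit_seq k)"
  have comb: "\<bar>(?f j x - ?f j y) + r * (?f k x - ?f k y)\<bar> \<le> mdist m x y"
    if "j \<noteq> k" "\<bar>r\<bar> \<le> 1" and x: "x \<in> mspace m" and y: "y \<in> mspace m" for j k r x y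
  proof -
    let ?a = "unit_seq j + r *\<^sub>R unit_seq k"
    have a: "?a \<in> c0" by (intro add_in_c0 scaleR_in_c0 unit_seq_in_c0)
    have "\<bar>U ?a x - U ?a y\<bar> \<le> lip_norm m (U ?a) * mdist m y x"
      by (rule lip_norm_bound[OF bspec[OF Lip a] y x])
    also have "\<dots> \<le> 1 * mdist m y x"
      by (rule mult_right_mono) (use bspec[OF norm a] norm_unit_seq_add_le that in auto)
    finally show ?thesis
      by (simp add: add scale scaleR_in_c0 unit_seq_in_c0 mdist_commute algebra_simps)
  qed
  \<comment> \<open>For reals u, v the larger of |u + v| and |u - v| is |u| + |v|.\<close>
  have "\<bar>?f j x - ?f j y\<bar> + \<bar>?f k x - ?f k y\<bar> \<le> mdist m x y"
    if "j \<noteq> k" "x \<in> mspace m" "y \<in> mspace m" for j k x y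
    using comb[OF that(1) _ that(2,3), of 1] comb[OF that(1) _ that(2,3), of "-1"] by simp
  moreover have "\<exists>p\<in>mspace m. \<exists>q\<in>mspace m. p \<noteq> q \<and> \<bar>?f k p - ?f k q\<bar> = mdist m p q" for k
  proof -
    obtain p q where pq: "p \<in> mspace m" "q \<in> mspace m" "p \<noteq> q"
      and eq: "lip_norm m (?f k) = \<bar>?f k p - ?f k q\<bar> / mdist m p q"
      using subsetD[OF SNA imageI[OF unit_seq_in_c0[of k]]]
      by (auto simp: SNA_def strongly_attains_norm_def)
    have "mdist m p q > 0" using pq by (rule mdist_pos)
    then have "\<bar>?f k p - ?f k q\<bar> = mdist m p q"
      using eq bspec[OF norm unit_seq_in_c0[of k]] by (simp add: norm_unit_seq field_simps)
    then show ?thesis using pq by blast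
  qed
  ultimately show ?thesis by (intro exI[of _ ?f]) blast
qed

text \<open>Without the subtracted fraction this is the distance between the leaves of a star with
  legs of length x + 1, for which the four-point inequality of the overview is an equality. The
  fraction lies in (0,1], which makes triangles strict and tips that equality.\<close>

definition nat_dist :: "nat \<Rightarrow> nat \<Rightarrow> real" where
  "nat_dist x y = (if x = y then 0 else real x + real y + 2 - 1 / (real (min x y) + 1))"

lemma nat_dist_less: "x < y \<Longrightarrow> nat_dist x y = real x + real y + 2 - 1 / (real x + 1)"
  by (simp add: nat_dist_def)

lemma nat_dist_commute: "nat_dist x y = nat_dist y x"
  by (simp add: nat_dist_def min.commute)

lemma nat_dist_ge: "x \<noteq> y \<Longrightarrow> nat_dist x y \<ge> real x + real y + 1"
  by (simp add: nat_dist_def)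

text \<open>Distances of distinct points lie in [x + y + 1, x + y + 2), so the detour through y
  costs at least x + 2y + z + 2.\<close>

lemma nat_dist_strict_triangle:
  assumes "x \<noteq> y" "y \<noteq> z"
  shows "nat_dist x z < nat_dist x y + nat_dist y z"
proof (cases "x = z")
  case True
  then show ?thesis
    using nat_dist_ge[OF assms(1)] nat_dist_ge[OF assms(2)] by (simp add: nat_dist_def)
next
  case False
  then have "nat_dist x z < real x + real z + 2" by (simp add: nat_dist_def)
  then show ?thesis using nat_dist_ge[OF assms(1)] nat_dist_ge[OF assms(2)] by simp
qed

interpretation nat_dist: Metric_space UNIV nat_dist
proof
  fix x y z :: nat
  show "0 \<le> nat_dist x y"
    using nat_dist_ge[of x y]
    by (cases "x = y") (simp add: nat_dist_def, linarith)
  show "nat_dist x y = nat_dist y x" by (rule nat_dist_commute)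
  show "nat_dist x y = 0 \<longleftrightarrow> x = y"
    using nat_dist_ge[of x y]
    by (cases "x = y") (simp add: nat_dist_def, simp)
  show "nat_dist x z \<le> nat_dist x y + nat_dist y z"
    using nat_dist_strict_triangle[of x y z]
    by (cases "x = y \<or> y = z") (auto simp: nat_dist_def[of x x for x])
qed

definition nat_metric :: "nat metric" where
  "nat_metric = metric (UNIV, nat_dist)"

lemma mspace_nat_metric [simp]: "mspace nat_metric = UNIV"
  and mdist_nat_metric [simp]: "mdist nat_metric = nat_dist"
  by (simp_all add: nat_metric_def)

lemma mtopology_of_nat_metric: "mtopology_of nat_metric = nat_dist.mtopology"
  by (simp add: mtopology_of_def)

lemma proper_nat_metric: "proper_metric nat_metric"
  unfolding proper_metric_def mspace_nat_metric mdist_nat_metric mtopology_of_nat_metric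
proof (intro allI impI, elim conjE)
  fix S assume "nat_dist.mbounded S"
  then obtain c B where B: "\<And>x. x \<in> S \<Longrightarrow> nat_dist c x \<le> B"
    unfolding nat_dist.mbounded_def by (auto simp: subset_iff)
  \<comment> \<open>A point other than \<open>c\<close> is at most its distance from
    \<open>c\<close>, so bounded sets are finite.\<close>
  have "S \<subseteq> insert c {..nat \<lceil>B\<rceil>}"
  proof
    fix x assume "x \<in> S"
    then have "x = c \<or> real x \<le> B" using B[of x] nat_dist_ge[of c x] by force
    then show "x \<in> insert c {..nat \<lceil>B\<rceil>}" by (auto simp: le_nat_iff) linarith
  qed
  then have "finite S" by (rule finite_subset) simp
  then show "compactin nat_dist.mtopology S" by (simp add: finite_imp_compactin)
qed

lemma mcomplete_nat_metric: "mcomplete_of nat_metric"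
  unfolding mcomplete_of_def mspace_nat_metric mdist_nat_metric
proof (unfold nat_dist.mcomplete_def, intro allI impI)
  fix s assume "nat_dist.MCauchy s"
  then obtain N where N: "\<And>n n'. N \<le> n \<Longrightarrow> N \<le> n' \<Longrightarrow> nat_dist (s n) (s n') < 1"
    unfolding nat_dist.MCauchy_def by (metis zero_less_one)
  \<comment> \<open>Distinct points are at distance at least 1, so a Cauchy sequence is eventually
    constant.\<close>
  have const: "s n = s N" if "N \<le> n" for n
    using N[OF that order_refl] nat_dist_ge[of "s n" "s N"] by fastforce
  have "eventually (\<lambda>n. s n = s N) sequentially"
    using eventually_ge_at_top[of N] by (rule eventually_mono) (rule const)
  then have "limitin nat_dist.mtopology s (s N) sequentially"
    by (intro limitin_eventually) simp_all
  then show "\<exists>x. limitin nat_dist.mtopology s x sequentially" by blast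
qed

lemma sep_radius_nat_metric_attained:
  obtains y where "y \<noteq> x" "sep_radius nat_metric x = nat_dist x y"
proof
  \<comment> \<open>If 0 is one of the two points, the fraction equals 1 and the lower bound x + w +
    1 is exact; hence the smallest admissible w is nearest.\<close>
  define y :: nat where "y = (if x = 0 then 1 else 0)"
  show "y \<noteq> x" by (simp add: y_def)
  have "nat_dist x y \<le> nat_dist x w" if "w \<noteq> x" for w
  proof -
    have "nat_dist x y \<le> real x + real w + 1"
      using that by (auto simp: y_def nat_dist_def)
    then show ?thesis using nat_dist_ge[of x w] that by simp
  qed
  then show "sep_radius nat_metric x = nat_dist x y"
    unfolding sep_radius_def mspace_nat_metric mdist_nat_metric
    by (intro cInf_eq_minimum) (use \<open>y \<noteq> x\<close> in auto)
qed

lemma uniformly_discrete_nat_metric: "uniformly_discrete nat_metric"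
proof -
  have "1 \<le> sep_radius nat_metric x" for x
  proof -
    obtain y where "y \<noteq> x" "sep_radius nat_metric x = nat_dist x y"
      by (rule sep_radius_nat_metric_attained)
    then show ?thesis using nat_dist_ge[of x y] by simp
  qed
  then have "1 \<le> (INF x\<in>mspace nat_metric. sep_radius nat_metric x)"
    by (intro cINF_greatest) auto
  then show ?thesis by (simp add: uniformly_discrete_def)
qed

lemma not_isometric_c0_in_SNA_nat_metric: "\<not> isometrically_contained_in_SNA c0 nat_metric z"
proof
  assume "isometrically_contained_in_SNA c0 nat_metric z"
  then obtain f :: "nat \<Rightarrow> nat \<Rightarrow> real" where
    sum: "\<And>j k x y. j \<noteq> k \<Longrightarrow> \<bar>f j x - f j y\<bar> + \<bar>f k x - f k y\<bar> \<le> nat_dist x y" and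
    att: "\<And>k. \<exists>p q. p \<noteq> q \<and> \<bar>f k p - f k q\<bar> = nat_dist p q"
    by (auto dest!: isometric_c0_in_SNA_imp_norming_pairs) blast
  \<comment> \<open>Ordering each pair makes \<open>p k\<close> the minimum that enters the
    fraction.\<close>
  have "\<exists>p q. p < q \<and> \<bar>f k p - f k q\<bar> = nat_dist p q" for k
    using att[of k] by (metis abs_minus_commute nat_dist_commute linorder_neqE_nat)
  then obtain p q where pq: "\<And>k. p k < q k"
    and at: "\<And>k. \<bar>f k (p k) - f k (q k)\<bar> = nat_dist (p k) (q k)"
    by metis
  have const: "f j (p k) = f j (q k)" if "j \<noteq> k" for j k
    using sum[OF that, of "p k" "q k"] at[of k] by simp
  show False
  proof (cases "\<exists>k. q 0 < p k")
    case True
    then obtain k where k: "q 0 < p k" by blast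
    then have "k \<noteq> 0" using pq[of 0] by (cases k) auto
    define V where "V g x y = \<bar>g x - g y\<bar>" for g :: "nat \<Rightarrow> real" and x y
    have est: "V (f k) x y + V (f 0) x y \<le> nat_dist x y" for x y
      using sum[OF \<open>k \<noteq> 0\<close>] by (simp add: V_def)
    \<comment> \<open>The two orientations let every cross pair be written with its point from
      \<open>p 0\<close>, \<open>q 0\<close> first.\<close>
    have tri: "V g x y \<le> V g x w + V g y w" "V g x y \<le> V g w x + V g w y" for g x y w
      by (simp_all add: V_def)
    have at0: "V (f 0) (p 0) (q 0) = nat_dist (p 0) (q 0)"
      and atk: "V (f k) (p k) (q k) = nat_dist (p k) (q k)"
      using at by (simp_all add: V_def)
    \<comment> \<open>Route \<open>f 0\<close> through \<open>p k\<close> and through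
      \<open>q k\<close>, and \<open>f k\<close> through \<open>p 0\<close> and through
      \<open>q 0\<close>: each cross pair then occurs once for either function, as
      \<open>est\<close> requires.\<close>
    have "2 * nat_dist (p 0) (q 0) + 2 * nat_dist (p k) (q k) \<le>
        nat_dist (p 0) (p k) + nat_dist (p 0) (q k) + nat_dist (q 0) (p k) + nat_dist (q 0) (q k)"
      using est[of "p 0" "p k"] est[of "p 0" "q k"] est[of "q 0" "p k"] est[of "q 0" "q k"] at0 atk
        tri(1)[of "f 0" "p 0" "q 0" "p k"] tri(1)[of "f 0" "p 0" "q 0" "q k"]
        tri(2)[of "f k" "p k" "q k" "p 0"] tri(2)[of "f k" "p k" "q k" "q 0"]
      by linarith
    \<comment> \<open>In every cross pair the smaller point is \<open>p 0\<close> or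
      \<open>q 0\<close>. The linear parts and the fractions of \<open>p 0\<close> cancel, leaving
      the reverse of this inequality.\<close>
    moreover have "1 / (real (p k) + 1) < 1 / (real (q 0) + 1)"
      using k by (simp add: divide_strict_left_mono)
    moreover have "p 0 < p k" "p 0 < q k" "q 0 < q k"
      using pq[of 0] pq[of k] k by linarith+
    ultimately show False using pq[of 0] pq[of k] k by (simp add: nat_dist_less)
  next
    case False
    then have "range p \<subseteq> {..q 0}" by (auto simp: not_less)
    then have "finite (range p)" by (rule finite_subset) simp
    then have "\<not> inj p" using finite_imageD infinite_UNIV_nat by blast
    then obtain j k where jk: "j \<noteq> k" "p j = p k" by (auto simp: inj_def)
    \<comment> \<open>Since \<open>f j\<close> agrees at \<open>p k\<close> and \<open>q k\<close>,
      it varies from \<open>q j\<close> to \<open>q k\<close> by the full distance of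
      \<open>q j\<close> and \<open>p j = p k\<close>. Likewise \<open>f k\<close> varies by that of
      \<open>p k\<close> and \<open>q k\<close>, and \<open>sum\<close> bounds the total.\<close>
    have "nat_dist (q j) (p k) + nat_dist (p k) (q k) \<le> nat_dist (q j) (q k)"
      using sum[OF jk(1), of "q j" "q k"] const[OF jk(1)] const[OF jk(1)[symmetric]] at[of j] at[of k]
        jk(2) nat_dist_commute[of "q j"] by simp
    then show False
      using nat_dist_strict_triangle[of "q j" "p k" "q k"] pq[of j] pq[of k] jk(2) by simp
  qed
qed

theorem theorem4p4:
  shows "\<exists>m :: nat metric.
           infinite (mspace m) \<and>
           proper_metric m \<and>
           uniformly_discrete m \<and>
           mcomplete_of m \<and>
           (\<forall>z\<in>mspace m. \<not> isometrically_contained_in_SNA c0 m z) \<and>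
           (\<forall>x\<in>mspace m. attains_sep_radius m x)"
proof (intro exI[of _ nat_metric] conjI ballI)
  show "infinite (mspace nat_metric)" by simp
  show "attains_sep_radius nat_metric x" for x
    unfolding attains_sep_radius_def using sep_radius_nat_metric_attained[of x] by auto
qed (simp_all add: proper_nat_metric uniformly_discrete_nat_metric mcomplete_nat_metric
    not_isometric_c0_in_SNA_nat_metric)

end
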